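(* Let $j\in\{2,\dots,J\}$, $i\in\{1,\dots,m_j\}$, and let $\Omega_i^{(j)}=\bigcup_{\ell=1}^{N_i}\Omega_{k_\ell}^{(j-1)}$ in a refinement chain. Suppose that the subsets $\{\Omega_{k_\ell}^{(j-1)}\}_{\ell=1}^{N_i}$ are either disjoint (construction (D)) or with fixed scenarios appearing in all of them (construction (F)). Then for each $\bm\lambda_i^{(j)}\in\Lambda_i^{(j)}$ there exists a collection of points $\{\bm\lambda_{k_\ell}^{(j-1)}\}_{\ell=1}^{N_i}$ with $\bm\lambda_{k_\ell}^{(j-1)}\in\Lambda_{k_\ell}^{(j-1)}$ for all $\ell=1,\dots,N_i$ such that $$\sum_{\ell=1}^{N_i}\pi_{k_\ell,i}^{(j-1,j)}\bm\lambda_{k_\ell}^{(j-1)}=\bm\lambda_i^{(j)}.$$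
   Context: Scenarios $\Omega=\{\bm\omega^1,\dots,\bm\omega^{|\mathcal S|}\}$, $\mathcal S=\{1,\dots,|\mathcal S|\}$, with probability measure $\mathbb P$, $p^s=\mathbb P(\bm\omega^s)>0$; $\bm W\in\mathbb R^{p\times m}$ and $\bm q^s\in\mathbb R^m$, $s\in\mathcal S$, are given. Refinement chain. For each level $j=1,\dots,J$ there is a collection $\{\Omega_i^{(j)}\}_{i=1}^{m_j}$ of nonempty subsets of $\Omega$, with $m_J=1$, $\Omega_1^{(J)}=\Omega$, such that (R1) $\Omega=\bigcup_i\Omega_i^{(j)}$ for each $j$; (R2) for $j\ge2$ each $\Omega_i^{(j)}$ is a union $\bigcup_{\ell=1}^{N_i}\Omega_{k_\ell}^{(j-1)}$ of sets of level $j-1$. Each $\Omega_i^{(j)}$ carries a probability measure $\mathbb P_i^{(j)}$ (with $\mathbb P_1^{(J)}=\mathbb P$) such that (P1) $\mathbb P_i^{(j)}$ has support $\Omega_i^{(j)}$; (P2) $\mathbb P=\sum_{i}\pi_i^{(j)}\mathbb P_i^{(j)}$ with intra-level weights $\pi_i^{(j)}\ge0$, $\sum_i\pi_i^{(j)}=1$; (P3) for $j\ge2$, $\mathbb P_i^{(j)}=\sum_{\ell=1}^{N_i}\pi_{k_\ell,i}^{(j-1,j)}\mathbb P_{k_\ell}^{(j-1)}$ with inter-level weights $\pi_{k_\ell,i}^{(j-1,j)}\ge0$, $\sum_\ell\pi_{k_\ell,i}^{(j-1,j)}=1$. Write $p^s_{\Omega_i^{(j)}}:=\mathbb P_i^{(j)}(\bm\omega^s)$.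 Construction (D), disjoint partitions: at each level the subsets are pairwise disjoint, $p^s_{\Omega_i^{(j)}}=p^s/\sum_{k:\bm\omega^k\in\Omega_i^{(j)}}p^k$ for $\bm\omega^s\in\Omega_i^{(j)}$, $\pi_i^{(j)}=\sum_{k:\bm\omega^k\in\Omega_i^{(j)}}p^k$. Construction (F), fixed scenarios: for some $f\ge1$ all subsets contain $F=\{\bm\omega^1,\dots,\bm\omega^f\}$; at each level every non-fixed scenario is in exactly one subset and every subset contains a non-fixed scenario; $p^s_{\Omega_i^{(j)}}=p^s$ for $s\le f$, $p^s_{\Omega_i^{(j)}}=\frac{1-\sum_{k=1}^fp^k}{\sum_{k:\bm\omega^k\in\Omega_i^{(j)}\setminus F}p^k}\,p^s$ for $\bm\omega^s\in\Omega_i^{(j)}\setminus F$, $\pi_i^{(j)}=\frac{\sum_{k:\bm\omega^k\in\Omega_i^{(j)}\setminus F}p^k}{1-\sum_{k=1}^fp^k}$. Dual feasible regions. $\Lambda_i^{(j)}=\prod_{s:\bm\omega^s\in\Omega_i^{(j)}}\{\bm\lambda^s\in\mathbb R^p:\bm W^\top\bm\lambda^s\le p^s_{\Omega_i^{(j)}}\bm q^s\}\subseteq\mathbb R^{p|\Omega_i^{(j)}|}$. When $\Omega_{k_\ell}^{(j-1)}\subseteq\Omega_i^{(j)}$, points of $\Lambda_{k_\ell}^{(j-1)}$ are regarded as vectors of $\mathbb R^{p|\Omega_i^{(j)}|}$ by setting to zero all components corresponding to scenarios of $\Omega_i^{(j)}$ not in $\Omega_{k_\ell}^{(j-1)}$.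 *)

theory Defs
  imports "HOL-Probability.Probability"
begin

text \<open>
  The scenarios are \<open>\<omega> 1, \<dots>, \<omega> n\<close>, pairwise distinct, with a probability measure \<open>P\<close> giving
  positive mass to each of them. Probability measures on the finite set of scenarios are rendered
  as \<open>pmf\<close>s, so that \<open>p\<^sup>s\<close> is \<open>pmf P (\<omega> s)\<close> and the support is \<open>set_pmf\<close>.
\<close>

definition scenarios :: "nat \<Rightarrow> (nat \<Rightarrow> 'w) \<Rightarrow> 'w pmf \<Rightarrow> bool" where
  "scenarios n \<omega> P \<longleftrightarrow> inj_on \<omega> {1..n} \<and> set_pmf P = \<omega> ` {1..n}"

definition idx :: "nat \<Rightarrow> (nat \<Rightarrow> 'w) \<Rightarrow> 'w set \<Rightarrow> nat set" where
  "idx n \<omega> A = {s \<in> {1..n}. \<omega> s \<in> A}"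

text \<open>
  In the notation of the paper: \<open>levels c\<close> is \<open>J\<close>, \<open>nsub c j\<close> is \<open>m\<^sub>j\<close>, \<open>sub c j i\<close> is
  \<open>\<Omega>\<^sub>i\<close> at level \<open>j\<close> with its probability measure \<open>meas c j i\<close> and intra-level
  weight \<open>weight c j i\<close>; \<open>nchild c j i\<close> is \<open>N\<^sub>i\<close>, \<open>child c j i l\<close> is the level \<open>j - 1\<close> index
  \<open>k\<^sub>l\<close>, and \<open>iweight c j k i\<close> is the inter-level weight \<open>\<pi>\<^bsub>k,i\<^esub>\<close> between levels \<open>j - 1\<close> and \<open>j\<close>.
\<close>

record 'w chain =
  levels :: nat
  nsub :: "nat \<Rightarrow> nat"
  sub :: "nat \<Rightarrow> nat \<Rightarrow> 'w set"
  meas :: "nat \<Rightarrow> nat \<Rightarrow> 'w pmf"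
  weight :: "nat \<Rightarrow> nat \<Rightarrow> real"
  nchild :: "nat \<Rightarrow> nat \<Rightarrow> nat"
  child :: "nat \<Rightarrow> nat \<Rightarrow> nat \<Rightarrow> nat"
  iweight :: "nat \<Rightarrow> nat \<Rightarrow> nat \<Rightarrow> real"

definition refinement_chain :: "nat \<Rightarrow> (nat \<Rightarrow> 'w) \<Rightarrow> 'w pmf \<Rightarrow> 'w chain \<Rightarrow> bool" where
  "refinement_chain n \<omega> P c \<longleftrightarrow>
     scenarios n \<omega> P \<and>
     1 \<le> levels c \<and>
     nsub c (levels c) = 1 \<and> sub c (levels c) 1 = \<omega> ` {1..n} \<and> meas c (levels c) 1 = P \<and>
     (\<forall>j\<in>{1..levels c}.
        (\<forall>i\<in>{1..nsub c j}. sub c j i \<noteq> {} \<and> sub c j i \<subseteq> \<omega> ` {1..n}) \<and>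
        \<omega> ` {1..n} = (\<Union>i\<in>{1..nsub c j}. sub c j i) \<and>
        (\<forall>i\<in>{1..nsub c j}. set_pmf (meas c j i) = sub c j i) \<and>
        (\<forall>i\<in>{1..nsub c j}. 0 \<le> weight c j i) \<and>
        (\<Sum>i=1..nsub c j. weight c j i) = 1 \<and>
        (\<forall>w. pmf P w = (\<Sum>i=1..nsub c j. weight c j i * pmf (meas c j i) w))) \<and>
     (\<forall>j\<in>{2..levels c}. \<forall>i\<in>{1..nsub c j}.
        (\<forall>l\<in>{1..nchild c j i}. child c j i l \<in> {1..nsub c (j - 1)}) \<and>
        sub c j i = (\<Union>l\<in>{1..nchild c j i}. sub c (j - 1) (child c j i l)) \<and>
        (\<forall>l\<in>{1..nchild c j i}. 0 \<le> iweight c j (child c j i l) i) \<and>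
        (\<Sum>l=1..nchild c j i. iweight c j (child c j i l) i) = 1 \<and>
        (\<forall>w. pmf (meas c j i) w =
           (\<Sum>l=1..nchild c j i.
              iweight c j (child c j i l) i * pmf (meas c (j - 1) (child c j i l)) w)))"

text \<open>
  The two constructions are stated for a collection \<open>I\<close> of indices of level \<open>j\<close>. A chain is built by
  construction (D) or (F) when the predicate holds with \<open>I = {1..nsub c j}\<close> at every level \<open>j\<close>
  (for (F), with the same \<open>f\<close>); by the monotonicity lemmas below it then holds for every
  subcollection, in particular for the sets making up one set of the next level. For
  \<open>I = {1..nsub c j}\<close> the union in the uniqueness clause of (F) is the set of all scenarios.
\<close>

definition disjoint_construction ::
  "nat \<Rightarrow> (nat \<Rightarrow> 'w) \<Rightarrow> 'w pmf \<Rightarrow> 'w chain \<Rightarrow> nat \<Rightarrow> nat set \<Rightarrow> bool" where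
  "disjoint_construction n \<omega> P c j I \<longleftrightarrow>
     disjoint_family_on (sub c j) I \<and>
     (\<forall>i\<in>I.
        (\<forall>s\<in>idx n \<omega> (sub c j i).
           pmf (meas c j i) (\<omega> s) = pmf P (\<omega> s) / (\<Sum>k\<in>idx n \<omega> (sub c j i). pmf P (\<omega> k))) \<and>
        weight c j i = (\<Sum>k\<in>idx n \<omega> (sub c j i). pmf P (\<omega> k)))"

definition fixed_construction ::
  "nat \<Rightarrow> (nat \<Rightarrow> 'w) \<Rightarrow> 'w pmf \<Rightarrow> 'w chain \<Rightarrow> nat \<Rightarrow> nat \<Rightarrow> nat set \<Rightarrow> bool" where
  "fixed_construction n \<omega> P c f j I \<longleftrightarrow>
     1 \<le> f \<and> f \<le> n \<and>
     (let F = \<omega> ` {1..f};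
          r = 1 - (\<Sum>k=1..f. pmf P (\<omega> k))
      in (\<forall>w \<in> (\<Union>i\<in>I. sub c j i) - F. \<exists>!i. i \<in> I \<and> w \<in> sub c j i) \<and>
         (\<forall>i\<in>I.
            F \<subseteq> sub c j i \<and> sub c j i - F \<noteq> {} \<and>
            (\<forall>s\<in>{1..f}. pmf (meas c j i) (\<omega> s) = pmf P (\<omega> s)) \<and>
            (\<forall>s\<in>idx n \<omega> (sub c j i - F).
               pmf (meas c j i) (\<omega> s) =
                 r / (\<Sum>k\<in>idx n \<omega> (sub c j i - F). pmf P (\<omega> k)) * pmf P (\<omega> s)) \<and>
            weight c j i = (\<Sum>k\<in>idx n \<omega> (sub c j i - F). pmf P (\<omega> k)) / r))"

lemma disjoint_construction_mono:
  assumes "disjoint_construction n \<omega> P c j I'" and "I \<subseteq> I'"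
  shows "disjoint_construction n \<omega> P c j I"
  using assms disjoint_family_on_mono[OF assms(2)]
  unfolding disjoint_construction_def by blast

lemma fixed_construction_mono:
  assumes "fixed_construction n \<omega> P c f j I'" and "I \<subseteq> I'"
  shows "fixed_construction n \<omega> P c f j I"
proof -
  have "\<exists>!i. i \<in> I \<and> w \<in> sub c j i" if "w \<in> (\<Union>i\<in>I. sub c j i) - \<omega> ` {1..f}" for w
  proof -
    have "w \<in> (\<Union>i\<in>I'. sub c j i) - \<omega> ` {1..f}"
      using that assms(2) by blast
    then have "\<exists>!i. i \<in> I' \<and> w \<in> sub c j i"
      using assms(1) unfolding fixed_construction_def Let_def by blast
    then show ?thesis
      using that assms(2) by blast
  qed
  then show ?thesis
    using assms unfolding fixed_construction_def Let_def by (auto simp: subset_iff)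
qed

text \<open>
  A vector indexed by the scenarios of \<open>sub c j i\<close>, with blocks in \<open>\<real>\<^sup>p\<close>, is represented by its
  extension by zero to all indices. Regarding a point of a region of level \<open>j - 1\<close> as a vector
  indexed by the scenarios of a larger set of level \<open>j\<close> is then the identity. The order on
  \<open>real ^ 'm\<close> is componentwise.
\<close>

definition dual_region ::
  "nat \<Rightarrow> (nat \<Rightarrow> 'w) \<Rightarrow> real ^ 'm ^ 'p \<Rightarrow> (nat \<Rightarrow> real ^ 'm) \<Rightarrow> 'w chain \<Rightarrow> nat \<Rightarrow> nat
    \<Rightarrow> (nat \<Rightarrow> real ^ 'p) set" where
  "dual_region n \<omega> W q c j i =
     {lam. (\<forall>s\<in>idx n \<omega> (sub c j i).
              transpose W *v lam s \<le> pmf (meas c j i) (\<omega> s) *\<^sub>R q s) \<and>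
           (\<forall>s. s \<notin> idx n \<omega> (sub c j i) \<longrightarrow> lam s = 0)}"

end

theory Submission
  imports Defs
begin

text \<open>
  Split \<open>lam\<close> scenario by scenario in proportion to the masses: the block of child \<open>k\<close> at scenario
  \<open>s\<close> is \<open>lam s\<close> scaled by the ratio of the mass of \<open>s\<close> under the child's measure to that under the
  parent's. Scaling carries the dual constraint of the parent to that of the child, and by the
  mixture identity (P3) the weighted ratios sum to one on the support of the parent's measure.
\<close>

text \<open>The factor \<open>t / r\<close> is nonnegative, so multiplying by it preserves the
  componentwise order, and \<open>r\<close> then cancels on the right because it is
  positive.\<close>

lemma scaled_dual_constraint:
  fixes A :: "real ^ 'p ^ 'm" and x :: "real ^ 'p" and b :: "real ^ 'm"
  assumes "A *v x \<le> r *\<^sub>R b" and "0 < r" and "0 \<le> t"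
  shows "A *v ((t / r) *\<^sub>R x) \<le> t *\<^sub>R b"
proof -
  have "A *v ((t / r) *\<^sub>R x) = (t / r) *\<^sub>R (A *v x)"
    by (rule matrix_vector_mult_scaleR)
  also have "\<dots> \<le> (t / r) *\<^sub>R (r *\<^sub>R b)"
    using assms by (intro scaleR_left_mono) auto
  also have "\<dots> = t *\<^sub>R b"
    using assms(2) by simp
  finally show ?thesis .
qed

theorem lemma3p3:
  fixes n :: nat and \<omega> :: "nat \<Rightarrow> 'w" and P :: "'w pmf" and c :: "'w chain"
    and W :: "real ^ 'm ^ 'p" and q :: "nat \<Rightarrow> real ^ 'm"
    and j i :: nat and lam :: "nat \<Rightarrow> real ^ 'p"
  assumes "refinement_chain n \<omega> P c"
    and "j \<in> {2..levels c}" and "i \<in> {1..nsub c j}"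
    and "disjoint_construction n \<omega> P c (j - 1) (child c j i ` {1..nchild c j i}) \<or>
         (\<exists>f. fixed_construction n \<omega> P c f (j - 1) (child c j i ` {1..nchild c j i}))"
    and "lam \<in> dual_region n \<omega> W q c j i"
  shows "\<exists>mu :: nat \<Rightarrow> nat \<Rightarrow> real ^ 'p.
           (\<forall>l\<in>{1..nchild c j i}.
              mu (child c j i l) \<in> dual_region n \<omega> W q c (j - 1) (child c j i l)) \<and>
           (\<lambda>s. \<Sum>l=1..nchild c j i. iweight c j (child c j i l) i *\<^sub>R mu (child c j i l) s) = lam"
proof -
  \<comment> \<open>The ratio depends on a child only through its measure, so indexing by
    \<open>k\<close> instead of the position \<open>l\<close> stays consistent even if a child is
    listed twice.\<close>
  define mu where "mu k s = (pmf (meas c (j - 1) k) (\<omega> s) / pmf (meas c j i) (\<omega> s)) *\<^sub>R lam s"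
    for k s
  have jm: "j - 1 \<in> {1..levels c}" "j \<in> {1..levels c}"
    using assms(2) by auto
  have supp: "set_pmf (meas c a b) = sub c a b" if "a \<in> {1..levels c}" "b \<in> {1..nsub c a}" for a b
    using assms(1) that unfolding refinement_chain_def by blast
  have "\<forall>j\<in>{2..levels c}. \<forall>i\<in>{1..nsub c j}.
      (\<forall>l\<in>{1..nchild c j i}. child c j i l \<in> {1..nsub c (j - 1)}) \<and>
      sub c j i = (\<Union>l\<in>{1..nchild c j i}. sub c (j - 1) (child c j i l)) \<and>
      (\<forall>w. pmf (meas c j i) w =
         (\<Sum>l=1..nchild c j i.
            iweight c j (child c j i l) i * pmf (meas c (j - 1) (child c j i l)) w))"
    using assms(1) unfolding refinement_chain_def by meson
  note step = bspec[OF bspec[OF this assms(2)] assms(3)]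
  have child: "child c j i l \<in> {1..nsub c (j - 1)}" if "l \<in> {1..nchild c j i}" for l
    using step that by blast
  have union: "sub c j i = (\<Union>l\<in>{1..nchild c j i}. sub c (j - 1) (child c j i l))"
    using step by (elim conjE)
  have mix: "pmf (meas c j i) w =
      (\<Sum>l=1..nchild c j i. iweight c j (child c j i l) i * pmf (meas c (j - 1) (child c j i l)) w)"
    for w
    using step by (elim conjE allE)
  \<comment> \<open>By (P1) the denominators of the ratios are nonzero on the parent's
    scenarios.\<close>
  have pos: "0 < pmf (meas c j i) (\<omega> s)" if "s \<in> idx n \<omega> (sub c j i)" for s
    using that supp[OF jm(2) assms(3)] by (auto simp: idx_def pmf_positive_iff)
  have lam: "transpose W *v lam s \<le> pmf (meas c j i) (\<omega> s) *\<^sub>R q s"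
    if "s \<in> idx n \<omega> (sub c j i)" for s
    using assms(5) that unfolding dual_region_def by blast
  have lam0: "lam s = 0" if "s \<notin> idx n \<omega> (sub c j i)" for s
    using assms(5) that unfolding dual_region_def by blast
  have "mu (child c j i l) \<in> dual_region n \<omega> W q c (j - 1) (child c j i l)"
    if l: "l \<in> {1..nchild c j i}" for l
  proof -
    let ?k = "child c j i l"
    have "transpose W *v mu ?k s \<le> pmf (meas c (j - 1) ?k) (\<omega> s) *\<^sub>R q s"
      if "s \<in> idx n \<omega> (sub c (j - 1) ?k)" for s
    proof -
      \<comment> \<open>The child's set lies in the parent's by (R2), so the parent's constraint is
        available at \<open>s\<close>.\<close>
      have "s \<in> idx n \<omega> (sub c j i)"
        using that l union by (auto simp: idx_def)
      then show ?thesis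
        unfolding mu_def by (intro scaled_dual_constraint lam pos) simp_all
    qed
    moreover have "mu ?k s = 0" if "s \<notin> idx n \<omega> (sub c (j - 1) ?k)" for s
    \<comment> \<open>For an index in range, (P1) for the child makes the numerator zero. Out of
      range, \<open>\<omega> s\<close> is arbitrary and may have positive mass, so the zero comes
      from \<open>lam s\<close> instead.\<close>
    proof (cases "s \<in> {1..n}")
      case True
      then have "pmf (meas c (j - 1) ?k) (\<omega> s) = 0"
        using that supp[OF jm(1) child[OF l]] by (simp add: idx_def pmf_eq_0_set_pmf)
      then show ?thesis
        by (simp add: mu_def)
    next
      case False
      then have "lam s = 0"
        by (intro lam0) (auto simp: idx_def)
      then show ?thesis
        by (simp add: mu_def)
    qed
    ultimately show ?thesis
      by (simp add: dual_region_def)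
  qed
  moreover have "(\<Sum>l=1..nchild c j i. iweight c j (child c j i l) i *\<^sub>R mu (child c j i l) s) = lam s"
    for s
  proof (cases "s \<in> idx n \<omega> (sub c j i)")
    case True
    let ?a = "\<lambda>l. iweight c j (child c j i l) i * pmf (meas c (j - 1) (child c j i l)) (\<omega> s)"
    have "(\<Sum>l=1..nchild c j i. iweight c j (child c j i l) i *\<^sub>R mu (child c j i l) s) =
        (\<Sum>l=1..nchild c j i. (?a l / pmf (meas c j i) (\<omega> s)) *\<^sub>R lam s)"
      by (simp add: mu_def)
    also have "\<dots> = (pmf (meas c j i) (\<omega> s) / pmf (meas c j i) (\<omega> s)) *\<^sub>R lam s"
      \<comment> \<open>Pulling out \<open>lam s\<close> and the common denominator leaves exactly
        the mixture sum of (P3), which is the parent's mass.\<close>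
      unfolding scaleR_sum_left[symmetric] sum_divide_distrib[symmetric] mix[symmetric] ..
    finally show ?thesis
      using pos[OF True] by simp
  next
    \<comment> \<open>Off the parent's scenarios \<open>lam s\<close> is zero, hence so is every
      summand.\<close>
    case False
    then show ?thesis
      by (simp add: mu_def lam0)
  qed
  ultimately show ?thesis
    by blast
qed

end
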